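(* Let $C>0$ and let $\psi_\varepsilon$ ($\varepsilon>0$) be the family of functions on $\mathbb{R}$ defined in the context. Then for all $p>2$, $$\varepsilon^{(p-2)/2}\,|\psi_\varepsilon(x)|^p\;\to\;K\,\delta(x)\quad\text{as }\varepsilon\to0^+$$ in the sense of generalized functions, where $$K=A^p\int_{-\infty}^{\infty}\frac{|y|^{p/6}}{\bigl(|y|^{2/3}+C\bigr)^p}\,dy$$ and $\delta(x)$ denotes the Dirac distribution at the origin. That is, for every $\varphi\in C_0^\infty(\mathbb{R})$, $$\lim_{\varepsilon\to0^+}\int_{-\infty}^{\infty}\varepsilon^{(p-2)/2}|\psi_\varepsilon(x)|^p\varphi(x)\,dx=K\varphi(0).$$
   Context: Fix $\epsilon\in\{1,-1\}$, real $\gamma\neq0$, real $b<0$, real $k_3$ and $C>0$ (in the paper $C=k_1^{2/3}k_2$ with real constants $k_1,k_2$). Put $$\delta_0=\frac{-3\epsilon-\sqrt{8\gamma^2+9}}{2\gamma},\qquad A=\Bigl(-\frac{4\delta_0}{3\gamma}\Bigr)^{1/2}>0,$$ and $$\psi_0(x)=\frac{A|x|^{1/6}}{|x|^{2/3}+C}\exp\Bigl[i\bigl(-\delta_0\ln(|x|^{2/3}+C)+k_3\bigr)\Bigr],\qquad x\in\mathbb{R}.$$ For $\varepsilon>0$ define $$\psi_\varepsilon(x)=\varepsilon^{-1/2}\exp\Bigl(\frac{ibx^2}{4\varepsilon}\Bigr)\psi_0\Bigl(\frac{x}{\varepsilon}\Bigr),\qquad x\in\mathbb{R}.$$ (In the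 paper $\varepsilon=a+bt$ with $a>0$, $b<0$, so $\varepsilon\to0^+$ corresponds to $t\to T^-$ with $T=-a/b$.) $C_0^\infty(\mathbb{R})$ is the space of infinitely differentiable functions with compact support; a family $f_\varepsilon$ of generalized functions converges to $f$ if $\langle f_\varepsilon,\varphi\rangle\to\langle f,\varphi\rangle$ for every test function $\varphi$, a locally integrable function $f_\varepsilon$ acting by integration. *)

theory Defs
  imports "HOL-Analysis.Analysis"
begin

subsection \<open>Test functions and generalized functions on the real line\<close>

definition smooth :: "(real \<Rightarrow> complex) \<Rightarrow> bool" where
  "smooth \<phi> \<longleftrightarrow>
     (\<forall>n x. ((\<lambda>f t. vector_derivative f (at t)) ^^ n) \<phi> differentiable (at x))"

definition test_functions :: "(real \<Rightarrow> complex) set" where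
  "test_functions = {\<phi>. smooth \<phi> \<and> compact (closure {x. \<phi> x \<noteq> 0})}"

type_synonym functional = "(real \<Rightarrow> complex) \<Rightarrow> complex"

definition locally_integrable :: "(real \<Rightarrow> complex) \<Rightarrow> bool" where
  "locally_integrable f \<longleftrightarrow> (\<forall>S. compact S \<longrightarrow> set_integrable lborel S f)"

text \<open>The pairing is bilinear (no conjugation). It is meaningful for locally integrable \<open>f\<close>;
  otherwise the integral may take the default value \<open>0\<close>.\<close>

definition regular_functional :: "(real \<Rightarrow> complex) \<Rightarrow> functional" where
  "regular_functional f \<phi> = (LINT x|lborel. f x * \<phi> x)"

definition dirac :: functional where
  "dirac \<phi> = \<phi> 0"

definition tendsto_gf :: "('i \<Rightarrow> functional) \<Rightarrow> functional \<Rightarrow> 'i filter \<Rightarrow> bool" where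
  "tendsto_gf T S F \<longleftrightarrow> (\<forall>\<phi>\<in>test_functions. ((\<lambda>i. T i \<phi>) \<longlongrightarrow> S \<phi>) F)"


subsection \<open>The family of functions\<close>

text \<open>The parameter \<open>s\<close> is the sign \<open>\<plusminus>1\<close>; \<open>e\<close> is the small positive parameter.
  Since \<open>0 powr a = 0\<close>, the powers of \<open>\<bar>x\<bar>\<close> have their usual values at \<open>x = 0\<close>.\<close>

definition delta0 :: "real \<Rightarrow> real \<Rightarrow> real" where
  "delta0 s \<gamma> = (- 3 * s - sqrt (8 * \<gamma>\<^sup>2 + 9)) / (2 * \<gamma>)"

definition amplitude :: "real \<Rightarrow> real \<Rightarrow> real" where
  "amplitude s \<gamma> = sqrt (- (4 * delta0 s \<gamma>) / (3 * \<gamma>))"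

definition psi0 :: "real \<Rightarrow> real \<Rightarrow> real \<Rightarrow> real \<Rightarrow> real \<Rightarrow> complex" where
  "psi0 s \<gamma> k3 C x =
     complex_of_real (amplitude s \<gamma> * \<bar>x\<bar> powr (1/6) / (\<bar>x\<bar> powr (2/3) + C)) *
     exp (\<i> * complex_of_real (- delta0 s \<gamma> * ln (\<bar>x\<bar> powr (2/3) + C) + k3))"

definition psi ::
  "real \<Rightarrow> real \<Rightarrow> real \<Rightarrow> real \<Rightarrow> real \<Rightarrow> real \<Rightarrow> real \<Rightarrow> complex" where
  "psi s \<gamma> b k3 C e x =
     complex_of_real (e powr (-1/2)) *
     exp (\<i> * complex_of_real (b * x\<^sup>2 / (4 * e))) * psi0 s \<gamma> k3 C (x / e)"

end

theory Submission
  imports Defs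
begin

text \<open>
  The phases in \<open>psi\<close> have modulus one, so only the self-similar profile survives in
  \<open>cmod (psi \<dots> e x) powr p\<close>: it equals \<open>e powr (- p / 2) * A powr p * h (x / e)\<close>,
  where \<open>A\<close> is the amplitude. The normalising factor \<open>e powr ((p - 2) / 2)\<close> turns this into
  \<open>A powr p * (h (x / e) / e)\<close>, the mass-preserving rescaling of a fixed function. Hence the
  claim is the classical statement that such rescalings of an integrable function concentrate
  at the origin (\<open>rescaling_tendsto_value_at_0\<close>), tested against bounded functions that are
  continuous there.

  The assumption \<open>p > 2\<close> is what makes \<open>h\<close> integrable: at infinity
  \<open>h y\<close> behaves like \<open>\<bar>y\<bar> powr (p / 6 - 2 * p / 3) = \<bar>y\<bar> powr (- p / 2)\<close>
  (\<open>profile_integrable\<close>).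
\<close>

text \<open>The substitution \<open>x = e * y\<close> moves the parameter from the kernel into the test function,
  giving \<open>h y *\<^sub>R \<phi> (e * y)\<close>. This converges pointwise to \<open>h y *\<^sub>R \<phi> 0\<close> and is dominated
  by a multiple of \<open>\<bar>h y\<bar>\<close>.\<close>

lemma rescaling_tendsto_value_at_0:
  fixes h :: "real \<Rightarrow> real" and \<phi> :: "real \<Rightarrow> 'a::{banach, second_countable_topology}"
  assumes h: "integrable lborel h"
    and \<phi>_measurable: "\<phi> \<in> borel_measurable borel"
    and \<phi>_bounded: "bounded (range \<phi>)"
    and \<phi>_cont: "isCont \<phi> 0"
  shows "((\<lambda>e. LINT x|lborel. (h (x / e) / e) *\<^sub>R \<phi> x) \<longlongrightarrow> (LINT y|lborel. h y) *\<^sub>R \<phi> 0)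
    (at_right 0)"
proof (rule tendsto_at_right_sequentially)
  show "(0::real) < 1" by simp
next
  fix S :: "nat \<Rightarrow> real"
  assume S_pos: "\<And>n. 0 < S n" and S_lim: "S \<longlonglongrightarrow> 0"
  obtain B where B: "\<And>x. norm (\<phi> x) \<le> B"
    using \<phi>_bounded by (auto simp: bounded_iff)
  have [measurable]: "h \<in> borel_measurable borel" "\<phi> \<in> borel_measurable borel"
    using borel_measurable_integrable[OF h] \<phi>_measurable by simp_all
  have "(LINT x|lborel. (h (x / S n) / S n) *\<^sub>R \<phi> x) = (LINT y|lborel. h y *\<^sub>R \<phi> (S n * y))" for n
    using S_pos[of n]
    by (subst lborel_integral_real_affine[where c = "S n" and t = 0])
       (simp_all flip: integral_scaleR_right)
  moreover have "(\<lambda>n. LINT y|lborel. h y *\<^sub>R \<phi> (S n * y)) \<longlonglongrightarrow> (LINT y|lborel. h y *\<^sub>R \<phi> 0)"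
  proof (rule integral_dominated_convergence[where w = "\<lambda>y. \<bar>h y\<bar> * B"])
    have "(\<lambda>n. S n * y) \<longlonglongrightarrow> 0" for y
      using tendsto_mult_right[OF S_lim, of y] by simp
    then show "AE y in lborel. (\<lambda>n. h y *\<^sub>R \<phi> (S n * y)) \<longlonglongrightarrow> h y *\<^sub>R \<phi> 0"
      by (intro AE_I2 tendsto_scaleR tendsto_const isCont_tendsto_compose[OF \<phi>_cont])
    show "AE y in lborel. norm (h y *\<^sub>R \<phi> (S n * y)) \<le> \<bar>h y\<bar> * B" for n
      using B by (auto intro!: mult_left_mono)
    show "integrable lborel (\<lambda>y. \<bar>h y\<bar> * B)"
      using h by (intro integrable_mult_left integrable_abs)
  qed measurable
  moreover have "(LINT y|lborel. h y *\<^sub>R \<phi> 0) = (LINT y|lborel. h y) *\<^sub>R \<phi> 0"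
    using h by simp
  ultimately show "(\<lambda>n. LINT x|lborel. (h (x / S n) / S n) *\<^sub>R \<phi> x) \<longlonglongrightarrow> (LINT y|lborel. h y) *\<^sub>R \<phi> 0"
    by simp
qed

lemma integrable_of_power_decay:
  fixes g :: "real \<Rightarrow> real"
  assumes q: "q > 1"
    and g_measurable: "g \<in> borel_measurable borel"
    and near: "\<And>y. \<bar>y\<bar> \<le> 1 \<Longrightarrow> \<bar>g y\<bar> \<le> M"
    and far: "\<And>y. \<bar>y\<bar> \<ge> 1 \<Longrightarrow> \<bar>g y\<bar> \<le> \<bar>y\<bar> powr (- q)"
  shows "integrable lborel g"
proof (rule Bochner_Integration.integrable_bound)
  define tail :: "real \<Rightarrow> real" where "tail = (\<lambda>y. indicator {1..} y * y powr (- q))"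
  have "(\<lambda>y::real. y powr (- q)) integrable_on {1..}"
    using has_integral_powr_to_inf[of "- q" 1] q by (auto intro: has_integral_integrable)
  then have "(\<lambda>y::real. y powr (- q)) absolutely_integrable_on {1..}"
    by (intro nonnegative_absolutely_integrable_1) auto
  then have tail: "integrable lborel tail"
    unfolding set_integrable_def tail_def by (subst (asm) integrable_completion) auto
  have core: "integrable lborel (indicator {-1..1} :: real \<Rightarrow> real)"
    by (intro integrable_real_indicator) auto
  show "integrable lborel (\<lambda>y. M * indicator {-1..1} y + (tail y + tail (- y)))"
    using lborel_integrable_real_affine[OF tail, of "-1" 0] tail core
    by (intro Bochner_Integration.integrable_add integrable_mult_right) simp_all
  show "g \<in> borel_measurable lborel"
    using g_measurable by simp
  have "\<bar>g y\<bar> \<le> M * indicator {-1..1} y + (tail y + tail (- y))" for y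
  proof (cases "\<bar>y\<bar> \<le> 1")
    case True
    then show ?thesis
      using near[OF True] by (auto simp: tail_def indicator_def intro: add_increasing2)
  next
    case False
    then show ?thesis
      using far[of y] by (auto simp: tail_def indicator_def abs_if split: if_splits)
  qed
  then show "AE y in lborel. norm (g y) \<le> norm (M * indicator {-1..1} y + (tail y + tail (- y)))"
    by (intro AE_I2) (metis abs_ge_self order_trans real_norm_def)
qed

text \<open>Dropping \<open>\<bar>y\<bar> powr (2/3)\<close> from the denominator bounds the profile on
  \<open>{-1..1}\<close>; dropping \<open>C\<close> instead gives the decay rate \<open>p / 2\<close> outside.\<close>

lemma profile_integrable:
  fixes C p :: real
  assumes C: "C > 0" and p: "p > 2"
  shows "integrable lborel (\<lambda>y. \<bar>y\<bar> powr (p / 6) / (\<bar>y\<bar> powr (2/3) + C) powr p)"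
proof (rule integrable_of_power_decay[where q = "p / 2" and M = "1 / C powr p"])
  fix y :: real
  show "\<bar>\<bar>y\<bar> powr (p / 6) / (\<bar>y\<bar> powr (2/3) + C) powr p\<bar> \<le> 1 / C powr p" if "\<bar>y\<bar> \<le> 1"
  proof -
    have "\<bar>y\<bar> powr (p / 6) \<le> 1"
      using that p by (intro powr_le1) auto
    moreover have "C powr p \<le> (\<bar>y\<bar> powr (2/3) + C) powr p"
      using C p by (intro powr_mono2) auto
    ultimately have "\<bar>y\<bar> powr (p / 6) / (\<bar>y\<bar> powr (2/3) + C) powr p \<le> 1 / C powr p"
      using C by (intro frac_le) auto
    then show ?thesis by simp
  qed
  show "\<bar>\<bar>y\<bar> powr (p / 6) / (\<bar>y\<bar> powr (2/3) + C) powr p\<bar> \<le> \<bar>y\<bar> powr (- (p / 2))" if y: "\<bar>y\<bar> \<ge> 1"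
  proof -
    have "(\<bar>y\<bar> powr (2/3)) powr p \<le> (\<bar>y\<bar> powr (2/3) + C) powr p"
      using C p by (intro powr_mono2) auto
    moreover have "0 < (\<bar>y\<bar> powr (2/3)) powr p"
      using y by auto
    ultimately have "\<bar>y\<bar> powr (p / 6) / (\<bar>y\<bar> powr (2/3) + C) powr p
        \<le> \<bar>y\<bar> powr (p / 6) / (\<bar>y\<bar> powr (2/3)) powr p"
      by (intro divide_left_mono mult_pos_pos) auto
    also have "\<dots> = \<bar>y\<bar> powr (- (p / 2))"
      using y by (simp add: powr_powr flip: powr_diff)
    finally show ?thesis by simp
  qed
qed (use p in simp_all)

text \<open>The definition takes the square root of \<open>- 4 * delta0 / (3 * \<gamma>)\<close>, and the real square root
  is odd, so a sign has to be checked: \<open>sqrt (8 * \<gamma>\<^sup>2 + 9) > 3\<close> outweighs \<open>- 3 * s\<close>.\<close>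

lemma amplitude_nonneg:
  assumes "s \<in> {1, -1}" and "\<gamma> \<noteq> 0"
  shows "amplitude s \<gamma> \<ge> 0"
proof -
  have "sqrt (8 * \<gamma>\<^sup>2 + 9) \<ge> 3"
    by (intro real_le_rsqrt) simp
  then have "0 \<le> 3 * s + sqrt (8 * \<gamma>\<^sup>2 + 9)"
    using assms by auto
  then have "0 \<le> 4 * (3 * s + sqrt (8 * \<gamma>\<^sup>2 + 9)) / (6 * \<gamma>\<^sup>2)"
    by (intro divide_nonneg_nonneg) auto
  also have "\<dots> = - (4 * delta0 s \<gamma>) / (3 * \<gamma>)"
    using assms by (simp add: delta0_def power2_eq_square field_simps)
  finally show ?thesis
    by (simp add: amplitude_def)
qed

lemma cmod_psi:
  assumes "s \<in> {1, -1}" and "\<gamma> \<noteq> 0" and "C > 0"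
  shows "cmod (psi s \<gamma> b k3 C e x) =
    e powr (-1/2) * (amplitude s \<gamma> * (\<bar>x / e\<bar> powr (1/6) / (\<bar>x / e\<bar> powr (2/3) + C)))"
proof -
  have "\<bar>x / e\<bar> powr (2/3) + C > 0"
    using assms(3) by (intro add_nonneg_pos) auto
  then show ?thesis
    using amplitude_nonneg[OF assms(1,2)]
    by (simp add: psi_def psi0_def norm_mult norm_divide del: of_real_add of_real_mult of_real_divide
        abs_divide)
qed

text \<open>The powers of \<open>e\<close> combine to \<open>(p - 2) / 2 - p / 2 = - 1\<close>.\<close>

lemma scaled_cmod_psi_powr:
  fixes e :: real
  assumes "s \<in> {1, -1}" and "\<gamma> \<noteq> 0" and C: "C > 0" and e: "e > 0"
  shows "e powr ((p - 2) / 2) * cmod (psi s \<gamma> b k3 C e x) powr p =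
    amplitude s \<gamma> powr p * (\<bar>x / e\<bar> powr (p / 6) / (\<bar>x / e\<bar> powr (2/3) + C) powr p / e)"
proof -
  define a where "a = \<bar>x / e\<bar>"
  have a: "a \<ge> 0" "a powr (2/3) + C > 0"
    using C by (auto simp: a_def intro: add_nonneg_pos)
  have A: "amplitude s \<gamma> \<ge> 0"
    by (rule amplitude_nonneg) fact+
  have "e powr ((p - 2) / 2) * (e powr (-1/2)) powr p = e powr (- 1)"
    by (simp add: powr_powr add_divide_distrib diff_divide_distrib flip: powr_add)
  also have "\<dots> = 1 / e"
    using e by (simp add: powr_minus_divide)
  finally have e_powers: "e powr ((p - 2) / 2) * (e powr (-1/2)) powr p = 1 / e" .
  have "cmod (psi s \<gamma> b k3 C e x) powr p =
      (e powr (-1/2)) powr p * (amplitude s \<gamma> powr p * (a powr (p / 6) / (a powr (2/3) + C) powr p))"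
    using a A e unfolding cmod_psi[OF assms(1-3)] a_def[symmetric]
    by (simp add: powr_mult powr_divide powr_powr)
  then have "e powr ((p - 2) / 2) * cmod (psi s \<gamma> b k3 C e x) powr p =
      (e powr ((p - 2) / 2) * (e powr (-1/2)) powr p) *
      (amplitude s \<gamma> powr p * (a powr (p / 6) / (a powr (2/3) + C) powr p))"
    by (simp only: mult.assoc)
  then show ?thesis
    unfolding e_powers a_def by simp
qed

lemma test_function_continuous:
  assumes "\<phi> \<in> test_functions"
  shows "continuous_on UNIV \<phi>"
proof -
  have "((\<lambda>f t. vector_derivative f (at t)) ^^ 0) \<phi> differentiable (at x)" for x
    using assms unfolding test_functions_def smooth_def by blast
  then show ?thesis
    by (auto intro!: continuous_at_imp_continuous_on differentiable_imp_continuous_within)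
qed

lemma test_function_bounded:
  assumes "\<phi> \<in> test_functions"
  shows "bounded (range \<phi>)"
proof -
  let ?S = "closure {x. \<phi> x \<noteq> 0}"
  have "compact ?S"
    using assms by (simp add: test_functions_def)
  then have "compact (\<phi> ` ?S)"
    using test_function_continuous[OF assms]
    by (intro compact_continuous_image) (auto intro: continuous_on_subset)
  then have "bounded (insert 0 (\<phi> ` ?S))"
    by (simp add: compact_imp_bounded)
  moreover have "range \<phi> \<subseteq> insert 0 (\<phi> ` ?S)"
    using closure_subset by fastforce
  ultimately show ?thesis
    by (rule bounded_subset)
qed

theorem theorem3:
  fixes s \<gamma> b k3 C p :: real
  assumes "s \<in> {1, -1}" and "\<gamma> \<noteq> 0" and "b < 0" and "C > 0" and "p > 2"
  defines "f \<equiv> \<lambda>e x. complex_of_real (e powr ((p - 2) / 2) * cmod (psi s \<gamma> b k3 C e x) powr p)"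
    and "h \<equiv> \<lambda>y::real. \<bar>y\<bar> powr (p / 6) / (\<bar>y\<bar> powr (2/3) + C) powr p"
  defines "K \<equiv> amplitude s \<gamma> powr p * (LINT y|lborel. h y)"
  shows "(\<forall>e>0. locally_integrable (f e)) \<and> integrable lborel h \<and>
    tendsto_gf (\<lambda>e. regular_functional (f e)) (\<lambda>\<phi>. complex_of_real K * dirac \<phi>) (at_right 0)"
proof (intro conjI allI impI)
  show h: "integrable lborel h"
    unfolding h_def by (rule profile_integrable) fact+
  define g where "g = (\<lambda>y. amplitude s \<gamma> powr p * h y)"
  have g: "integrable lborel g" "(LINT y|lborel. g y) = K"
    using h by (simp_all add: g_def K_def)
  have f_eq: "f e = (\<lambda>x. complex_of_real (g (x / e) / e))" if "e > 0" for e
    unfolding f_def g_def h_def scaled_cmod_psi_powr[OF assms(1,2,4) that] by simp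
  show "locally_integrable (f e)" if "e > 0" for e
  proof -
    have "integrable lborel (\<lambda>x. g (x / e))"
      using lborel_integrable_real_affine[OF g(1), of "1 / e" 0] that by simp
    then have "integrable lborel (f e)"
      unfolding f_eq[OF that] by (intro integrable_of_real integrable_divide_zero)
    then show ?thesis
      by (auto simp: locally_integrable_def set_integrable_def compact_imp_closed
          intro!: integrable_mult_indicator)
  qed
  show "tendsto_gf (\<lambda>e. regular_functional (f e)) (\<lambda>\<phi>. complex_of_real K * dirac \<phi>) (at_right 0)"
    unfolding tendsto_gf_def
  proof
    fix \<phi> assume \<phi>: "\<phi> \<in> test_functions"
    note cont = test_function_continuous[OF \<phi>]
    have "((\<lambda>e. LINT x|lborel. (g (x / e) / e) *\<^sub>R \<phi> x) \<longlongrightarrow> K *\<^sub>R \<phi> 0) (at_right 0)"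
      unfolding g(2)[symmetric]
      using g(1) test_function_bounded[OF \<phi>] cont
      by (intro rescaling_tendsto_value_at_0 borel_measurable_continuous_onI)
         (auto simp: continuous_on_eq_continuous_at)
    moreover have "\<forall>\<^sub>F e in at_right 0.
        (LINT x|lborel. (g (x / e) / e) *\<^sub>R \<phi> x) = regular_functional (f e) \<phi>"
      using eventually_at_right_less[of "0::real"]
      by eventually_elim (simp add: regular_functional_def f_eq scaleR_conv_of_real)
    ultimately show "((\<lambda>e. regular_functional (f e) \<phi>) \<longlongrightarrow> complex_of_real K * dirac \<phi>) (at_right 0)"
      by (auto simp: dirac_def scaleR_conv_of_real elim!: Lim_transform_eventually)
  qed
qed

end
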